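(* Let $S_n$ and $s_n$ denote the large and small Schröder numbers, and let $A134425[n]$, $A225887[n]$, $A114710[n]$ ($n\ge 0$) be the integer sequences defined in the context. For a tuple $v=(v_1,\ldots,v_n)$ of nonnegative integers write $\widetilde v=v_1+2v_2+\cdots+nv_n$, $|v|=v_1+\cdots+v_n$ and $\binom{|v|}{v_1,\ldots,v_n}=\frac{|v|!}{v_1!\cdots v_n!}$. Then the following formulas hold for all $n\ge 1$, unless stated otherwise, where each sum is over all tuples $v=(v_1,\ldots,v_n)$ of nonnegative integers with $\widetilde v=n$: \begin{align*} \sum_{\widetilde v=n}(-1)^{|v|-1}\binom{|v|}{v_1,\ldots,v_n}S_1^{v_1}S_2^{v_2}\cdots S_n^{v_n}&=S_{n-1}\quad(n\ge2),\\ \sum_{\widetilde v=n}\binom{|v|}{v_1,\ldots,v_n}S_1^{v_1}S_2^{v_2}\cdots S_n^{v_n}&=2\cdot A134425[n-1],\\ \sum_{\widetilde v=n}(-1)^{|v|-1}\binom{|v|}{v_1,\ldots,v_n}S_0^{v_1}S_1^{v_2}\cdots S_{n-1}^{v_n}&=s_{n-1},\\ \sum_{\widetilde v=n}\binom{|v|}{v_1,\ldots,v_n}S_0^{v_1}S_1^{v_2}\cdots S_{n-1}^{v_n}&=s_n,\\ \sum_{\widetilde v=n}(-1)^{|v|-1}\binom{|v|}{v_1,\ldots,v_n}s_1^{v_1}s_2^{v_2}\cdots s_n^{v_n}&=S_{n-1},\\ \sum_{\widetilde v=n}\binom{|v|}{v_1,\ldots,v_n}s_1^{v_1}s_2^{v_2}\cdots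 s_n^{v_n}&=A225887[n-1],\\ \sum_{\widetilde v=n}(-1)^{|v|-1}\binom{|v|}{v_1,\ldots,v_n}s_0^{v_1}s_1^{v_2}\cdots s_{n-1}^{v_n}&=A114710[n-1],\\ \sum_{\widetilde v=n}\binom{|v|}{v_1,\ldots,v_n}s_0^{v_1}s_1^{v_2}\cdots s_{n-1}^{v_n}&=S_{n-1},\\ \sum_{\widetilde v=n}(-1)^{|v|-1}\binom{|v|}{v_1,\ldots,v_n}s_2^{v_1}s_3^{v_2}\cdots s_{n+1}^{v_n}&=S_{n-1}\quad(n\ge2). \end{align*}
   Context: Large Schröder numbers: $S_0=1$ and $S_n=\frac1n\sum_{k=1}^n 2^k\binom nk\binom n{k-1}$ for $n\ge 1$. Small Schröder numbers: $s_0=1$ and $s_n=\frac12 S_n$ for $n\ge1$. Schröder paths: for $n\ge0$, $\mathcal P_n$ is the set of lattice paths from $(0,0)$ to $(2n,0)$ with steps $u=(1,1)$, $d=(1,-1)$, $h=(2,0)$ that never go below the $x$-axis ($\mathcal P_0$ consists of the empty path only). A low $h$ step is an $h$ step lying on the $x$-axis; $\mathrm{low}(\lambda)$ denotes the number of low $h$ steps of $\lambda$. A peak of height $1$ is a $u$ step ending at height $1$ immediately followed by a $d$ step. OEIS sequences ($n\ge 0$): $A134425[n]=\sum_{\lambda\in\mathcal P_n}4^{\mathrm{low}(\lambda)}$ (Schröder paths whose low $h$ steps come in four kinds); $A225887[n]=\sum_{\lambda\in\mathcal P_n}3^{\mathrm{low}(\lambda)}$ (Schröder paths whose low $h$ steps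 come in three colors); $A114710[n]$ is the number of $\lambda\in\mathcal P_n$ having no low $h$ steps and no peaks of height $1$. *)

theory Defs
  imports Complex_Main "HOL-Library.FuncSet"
begin

text \<open>
  The Schroeder numbers are rational-valued, so that \<open>/\<close> is exact division; their
  integrality plays no role in the definitions.
\<close>

definition large_schroeder :: "nat \<Rightarrow> rat" where
  "large_schroeder n =
     (if n = 0 then 1
      else 1 / of_nat n * (\<Sum>k = 1..n. 2 ^ k * of_nat (n choose k) * of_nat (n choose (k - 1))))"

definition small_schroeder :: "nat \<Rightarrow> rat" where
  "small_schroeder n = (if n = 0 then 1 else 1 / 2 * large_schroeder n)"


datatype step = U | D | H

fun dx :: "step \<Rightarrow> int" where
  "dx U = 1"
| "dx D = 1"
| "dx H = 2"

fun dy :: "step \<Rightarrow> int" where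
  "dy U = 1"
| "dy D = - 1"
| "dy H = 0"

text \<open>
  A path starting at the origin is the list of its steps; \<open>vertex p i\<close> is the lattice point
  reached after the first \<open>i\<close> steps, so step \<open>p ! i\<close> leads from \<open>vertex p i\<close> to
  \<open>vertex p (Suc i)\<close>.
\<close>

definition vertex :: "step list \<Rightarrow> nat \<Rightarrow> int \<times> int" where
  "vertex p i = (sum_list (map dx (take i p)), sum_list (map dy (take i p)))"

definition schroeder_paths :: "nat \<Rightarrow> step list set" where
  "schroeder_paths n =
     {p. vertex p (length p) = (2 * int n, 0) \<and> (\<forall>i \<le> length p. snd (vertex p i) \<ge> 0)}"

definition low :: "step list \<Rightarrow> nat" where
  "low p = card {i. i < length p \<and> p ! i = H \<and> snd (vertex p i) = 0}"

definition has_peak_of_height :: "step list \<Rightarrow> int \<Rightarrow> bool" where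
  "has_peak_of_height p y \<longleftrightarrow>
     (\<exists>i. Suc i < length p \<and> p ! i = U \<and> snd (vertex p (Suc i)) = y \<and> p ! Suc i = D)"

lemma length_le_sum_list_dx: "int (length p) \<le> sum_list (map dx p)"
proof (induction p)
  case (Cons a p)
  then show ?case by (cases a) auto
qed simp

text \<open>Finiteness makes the sums and the cardinality over \<open>schroeder_paths n\<close> genuine ones.\<close>

lemma finite_schroeder_paths: "finite (schroeder_paths n)"
proof (rule finite_subset)
  have "length p \<le> 2 * n" if "p \<in> schroeder_paths n" for p
    using that length_le_sum_list_dx[of p] by (simp add: schroeder_paths_def vertex_def)
  moreover have "x \<in> {U, D, H}" for x
    by (cases x) auto
  ultimately show "schroeder_paths n \<subseteq> {p. set p \<subseteq> {U, D, H} \<and> length p \<le> 2 * n}"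
    by blast
  show "finite {p. set p \<subseteq> {U, D, H} \<and> length p \<le> 2 * n}"
    by (rule finite_lists_length_le) simp
qed

definition A134425 :: "nat \<Rightarrow> nat" where
  "A134425 n = (\<Sum>p \<in> schroeder_paths n. 4 ^ low p)"

definition A225887 :: "nat \<Rightarrow> nat" where
  "A225887 n = (\<Sum>p \<in> schroeder_paths n. 3 ^ low p)"

definition A114710 :: "nat \<Rightarrow> nat" where
  "A114710 n = card {p \<in> schroeder_paths n. low p = 0 \<and> \<not> has_peak_of_height p 1}"


text \<open>
  A tuple \<open>(v\<^sub>1, \<dots>, v\<^sub>n)\<close> is an extensional function on \<open>{1..n}\<close>, so that distinct elements of
  \<open>tuples n\<close> are distinct tuples.
\<close>

definition tuples :: "nat \<Rightarrow> (nat \<Rightarrow> nat) set" where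
  "tuples n = {v \<in> {1..n} \<rightarrow>\<^sub>E UNIV. (\<Sum>i = 1..n. i * v i) = n}"

definition tuple_sum :: "nat \<Rightarrow> (nat \<Rightarrow> nat) \<Rightarrow> nat" where
  "tuple_sum n v = (\<Sum>i = 1..n. v i)"

definition multinom :: "nat \<Rightarrow> (nat \<Rightarrow> nat) \<Rightarrow> rat" where
  "multinom n v = fact (tuple_sum n v) / (\<Prod>i = 1..n. fact (v i))"

lemma finite_tuples: "finite (tuples n)"
proof (rule finite_subset)
  show "tuples n \<subseteq> {1..n} \<rightarrow>\<^sub>E {..n}"
  proof
    fix v assume v: "v \<in> tuples n"
    have "v i \<le> n" if i: "i \<in> {1..n}" for i
    proof -
      have "v i \<le> i * v i" using i by simp
      also have "\<dots> \<le> (\<Sum>j = 1..n. j * v j)"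
        using i by (intro member_le_sum) auto
      also have "\<dots> = n" using v by (simp add: tuples_def)
      finally show ?thesis .
    qed
    then show "v \<in> {1..n} \<rightarrow>\<^sub>E {..n}"
      using v by (auto simp: tuples_def PiE_iff)
  qed
  show "finite ({1..n} \<rightarrow>\<^sub>E {..n})"
    by (intro finite_PiE) auto
qed

end

theory Submission
  imports Defs "HOL-Computational_Algebra.Formal_Power_Series"
begin

text \<open>
  Splitting one part off a composition shows that the unsigned sums are the coefficients of
  \<open>1 / (1 - A)\<close>, where \<open>A = \<Sum>\<^sub>i a\<^sub>i x\<^sup>i\<close> is the generating function of the numbers raised to the
  powers \<open>v\<^sub>i\<close>, and the signed ones are those of \<open>- 1 / (1 + A)\<close>. The decomposition of a path
  at its first return to the axis gives \<open>S = 1 + x S + x S\<^sup>2\<close> for the generating function \<open>S\<close>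
  of all paths, and Lagrange inversion identifies its coefficients with the closed formula for
  the large Schroeder numbers. The same decomposition gives \<open>F = 1 + q x F + x S F\<close> if each low
  \<open>h\<close> step has weight \<open>q\<close>, and \<open>G = 1 + x (S - 1) G\<close> if low \<open>h\<close> steps and peaks of height 1 are
  forbidden, because such a peak is a first return around an empty path. All nine formulas are
  then consequences of these equations and \<open>2 s = 1 + S\<close>.
\<close>

unbundle fps_syntax

section \<open>Multinomial sums over compositions\<close>

text \<open>The length \<open>m\<close> of the tuples stays fixed while the weight \<open>k\<close> decreases in the recursion.\<close>

definition weighted_tuples :: "nat \<Rightarrow> nat \<Rightarrow> (nat \<Rightarrow> nat) set" where
  "weighted_tuples m k = {v \<in> {1..m} \<rightarrow>\<^sub>E UNIV. (\<Sum>i = 1..m. i * v i) = k}"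

definition tuple_term :: "(nat \<Rightarrow> rat) \<Rightarrow> nat \<Rightarrow> (nat \<Rightarrow> nat) \<Rightarrow> rat" where
  "tuple_term a m v = multinom m v * (\<Prod>i = 1..m. a i ^ v i)"

lemma finite_weighted_tuples: "finite (weighted_tuples m k)"
proof (rule finite_subset)
  show "weighted_tuples m k \<subseteq> {1..m} \<rightarrow>\<^sub>E {..k}"
  proof
    fix v assume v: "v \<in> weighted_tuples m k"
    have "v i \<le> k" if i: "i \<in> {1..m}" for i
    proof -
      have "v i \<le> i * v i" using i by simp
      also have "\<dots> \<le> (\<Sum>j = 1..m. j * v j)"
        using i by (intro member_le_sum) auto
      also have "\<dots> = k" using v by (simp add: weighted_tuples_def)
      finally show ?thesis .
    qed
    then show "v \<in> {1..m} \<rightarrow>\<^sub>E {..k}"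
      using v by (auto simp: weighted_tuples_def PiE_iff)
  qed
  show "finite ({1..m} \<rightarrow>\<^sub>E {..k})"
    by (intro finite_PiE) auto
qed

text \<open>Raising \<open>v i\<close> by one puts a factor |v| + 1 into the numerator,
  \<open>Suc (v i)\<close> into the denominator and \<open>a i\<close> into the monomial; here the
  denominators are cleared.\<close>

lemma tuple_term_Suc:
  assumes "i \<in> {1..m}"
  shows "of_nat (Suc (v i)) * tuple_term a m (v(i := Suc (v i)))
    = of_nat (Suc (tuple_sum m v)) * a i * tuple_term a m v"
proof -
  let ?w = "v(i := Suc (v i))" and ?J = "{1..m} - {i}"
  have sum: "tuple_sum m ?w = Suc (tuple_sum m v)"
    using assms by (simp add: tuple_sum_def sum.remove[of _ i])
  have pow: "(\<Prod>j = 1..m. a j ^ ?w j) = a i * (\<Prod>j = 1..m. a j ^ v j)"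
  proof -
    have "(\<Prod>j = 1..m. a j ^ ?w j) = a i ^ Suc (v i) * (\<Prod>j \<in> ?J. a j ^ v j)"
      using assms by (simp add: prod.remove[of _ i])
    also have "\<dots> = a i * (\<Prod>j = 1..m. a j ^ v j)"
      using assms by (simp add: prod.remove[of _ i])
    finally show ?thesis .
  qed
  have fct: "(\<Prod>j = 1..m. fact (?w j)) = of_nat (Suc (v i)) * (\<Prod>j = 1..m. fact (v j) :: rat)"
  proof -
    have "(\<Prod>j = 1..m. fact (?w j)) = fact (Suc (v i)) * (\<Prod>j \<in> ?J. fact (v j) :: rat)"
      using assms by (simp add: prod.remove[of _ i])
    also have "\<dots> = of_nat (Suc (v i)) * (\<Prod>j = 1..m. fact (v j) :: rat)"
      using assms by (simp add: prod.remove[of _ i])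
    finally show ?thesis .
  qed
  have nz: "(of_nat (Suc (v i)) :: rat) \<noteq> 0"
    by (rule of_nat_neq_0)
  show ?thesis
    unfolding tuple_term_def multinom_def sum pow fct fact_Suc using nz
    by (simp add: field_simps del: of_nat_Suc)
qed

text \<open>Multinomial form of Pascal's rule: an arrangement of the parts is determined by its
  first part \<open>i\<close> and an arrangement of the others.\<close>

lemma tuple_term_recursion:
  assumes "tuple_sum m v > 0"
  shows "tuple_term a m v
    = (\<Sum>i | i \<in> {1..m} \<and> v i > 0. a i * tuple_term a m (v(i := v i - 1)))"
proof -
  let ?N = "of_nat (tuple_sum m v) :: rat" and ?I = "{i. i \<in> {1..m} \<and> v i > 0}"
  have step: "of_nat (v i) * tuple_term a m v = ?N * (a i * tuple_term a m (v(i := v i - 1)))"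
    if i: "i \<in> ?I" for i
  proof -
    let ?u = "v(i := v i - 1)"
    have "Suc (tuple_sum m ?u) = tuple_sum m v"
      using i by (simp add: tuple_sum_def sum.remove[of _ i])
    with tuple_term_Suc[of i m ?u a] i show ?thesis
      by (simp add: mult.assoc)
  qed
  \<comment> \<open>Since |v| is the sum of the \<open>v i\<close>, \<open>step\<close> applies to
    each summand, and the common factor |v| > 0 cancels.\<close>
  have "?N * tuple_term a m v = (\<Sum>i \<in> {1..m}. of_nat (v i) * tuple_term a m v)"
    by (simp add: tuple_sum_def sum_distrib_right)
  also have "\<dots> = (\<Sum>i \<in> ?I. of_nat (v i) * tuple_term a m v)"
    by (rule sum.mono_neutral_right) auto
  also have "\<dots> = ?N * (\<Sum>i \<in> ?I. a i * tuple_term a m (v(i := v i - 1)))"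
    by (simp only: step sum_distrib_left cong: sum.cong)
  finally show ?thesis using assms by simp
qed

lemma tuple_sum_pos:
  assumes "v \<in> weighted_tuples m k" "0 < k"
  shows "tuple_sum m v > 0"
proof (rule gr0I)
  assume "tuple_sum m v = 0"
  then have "(\<Sum>i = 1..m. i * v i) = 0"
    by (simp add: tuple_sum_def)
  with assms show False
    by (simp add: weighted_tuples_def)
qed

text \<open>Removing one part \<open>i\<close> is a bijection from the tuples of weight
  \<open>k\<close> with \<open>v i > 0\<close> onto those of weight \<open>k - i\<close>. The bound
  \<open>k \<le> m\<close> makes every possible part an index.\<close>

lemma sum_tuple_term_recursion:
  assumes "0 < k" "k \<le> m"
  shows "(\<Sum>v \<in> weighted_tuples m k. tuple_term a m v)
    = (\<Sum>i = 1..k. a i * (\<Sum>v \<in> weighted_tuples m (k - i). tuple_term a m v))"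
proof -
  let ?W = "weighted_tuples m"
  have "(\<Sum>v \<in> ?W k. tuple_term a m v)
      = (\<Sum>v \<in> ?W k. \<Sum>i | i \<in> {1..m} \<and> v i > 0. a i * tuple_term a m (v(i := v i - 1)))"
    using \<open>0 < k\<close> by (intro sum.cong tuple_term_recursion tuple_sum_pos) auto
  also have "\<dots> = (\<Sum>i = 1..m. \<Sum>v | v \<in> ?W k \<and> v i > 0. a i * tuple_term a m (v(i := v i - 1)))"
    using finite_weighted_tuples by (intro sum.swap_restrict) auto
  also have "\<dots> = (\<Sum>i = 1..k. \<Sum>v | v \<in> ?W k \<and> v i > 0. a i * tuple_term a m (v(i := v i - 1)))"
  proof (rule sum.mono_neutral_right)
    have "v i = 0" if "i \<in> {1..m} - {1..k}" "v \<in> ?W k" for i v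
    proof (rule ccontr)
      assume "v i \<noteq> 0"
      have "i * v i \<le> (\<Sum>j = 1..m. j * v j)"
        using that by (intro member_le_sum) auto
      also have "\<dots> = k" using that by (simp add: weighted_tuples_def)
      finally have "i * v i \<le> k" .
      moreover have "i * 1 \<le> i * v i" using \<open>v i \<noteq> 0\<close> by (intro mult_le_mono) auto
      ultimately have "i \<le> k" by linarith
      with that show False by auto
    qed
    then show "\<forall>i\<in>{1..m} - {1..k}. (\<Sum>v | v \<in> ?W k \<and> v i > 0. a i * tuple_term a m (v(i := v i - 1))) = 0"
      by (metis (mono_tags, lifting) less_irrefl mem_Collect_eq sum.neutral)
  qed (use \<open>k \<le> m\<close> in auto)
  also have "\<dots> = (\<Sum>i = 1..k. a i * (\<Sum>v \<in> ?W (k - i). tuple_term a m v))"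
  proof (rule sum.cong)
    fix i assume i: "i \<in> {1..k}"
    then have im: "i \<in> {1..m}" using \<open>k \<le> m\<close> by auto
    have weight: "(\<Sum>j = 1..m. j * (v(i := x)) j) = i * x + (\<Sum>j \<in> {1..m} - {i}. j * v j)" for v x
      using im by (simp add: sum.remove[of _ i])
    have weight': "(\<Sum>j = 1..m. j * v j) = i * v i + (\<Sum>j \<in> {1..m} - {i}. j * v j)" for v
      using weight[of v "v i"] by simp
    have "(\<Sum>v | v \<in> ?W k \<and> v i > 0. a i * tuple_term a m (v(i := v i - 1)))
        = (\<Sum>v \<in> ?W (k - i). a i * tuple_term a m v)"
    proof (rule sum.reindex_bij_witness[where i = "\<lambda>v. v(i := Suc (v i))" and j = "\<lambda>v. v(i := v i - 1)"])
      fix v assume v: "v \<in> {v \<in> ?W k. v i > 0}"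
      then obtain x where "v i = Suc x" by (auto simp: gr0_conv_Suc)
      with v im show "v(i := v i - 1) \<in> ?W (k - i)"
        unfolding weighted_tuples_def mem_Collect_eq weight
        using weight'[of v] by (auto simp: PiE_iff extensional_def)
    next
      fix v assume v: "v \<in> ?W (k - i)"
      with im i show "v(i := Suc (v i)) \<in> {v \<in> ?W k. v i > 0}"
        unfolding weighted_tuples_def mem_Collect_eq weight
        using weight'[of v] by (auto simp: PiE_iff extensional_def)
    qed auto
    then show "(\<Sum>v | v \<in> ?W k \<and> v i > 0. a i * tuple_term a m (v(i := v i - 1)))
        = a i * (\<Sum>v \<in> ?W (k - i). tuple_term a m v)"
      by (simp add: sum_distrib_left)
  qed simp
  finally show ?thesis .
qed

lemma weighted_tuples_0: "weighted_tuples m 0 = {\<lambda>i \<in> {1..m}. 0}"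
  by (auto simp: weighted_tuples_def PiE_iff extensional_def fun_eq_iff)

lemma sum_tuple_term_0: "(\<Sum>v \<in> weighted_tuples m 0. tuple_term a m v) = 1"
  by (simp add: weighted_tuples_0 tuple_term_def multinom_def tuple_sum_def)

text \<open>The coefficients of \<open>F = 1 + A * F\<close> obey the same recursion and start at 1;
  \<open>A $ 0 = 0\<close> keeps \<open>F $ k\<close> itself out of the right-hand side.\<close>

lemma sum_tuple_term_eq_fps_nth:
  assumes "(1 - A) * F = 1" "A $ 0 = 0" "k \<le> m"
  shows "(\<Sum>v \<in> weighted_tuples m k. tuple_term (fps_nth A) m v) = F $ k"
  using \<open>k \<le> m\<close>
proof (induction k rule: less_induct)
  case (less k)
  have F: "F = 1 + A * F"
    using assms(1) by (simp add: algebra_simps)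
  show ?case
  proof (cases "k = 0")
    case True
    have "F $ 0 = 1"
      using arg_cong[OF F, of "\<lambda>f. f $ 0"] \<open>A $ 0 = 0\<close> by simp
    then show ?thesis
      using True sum_tuple_term_0 by simp
  next
    case False
    then have "(\<Sum>v \<in> weighted_tuples m k. tuple_term (fps_nth A) m v)
        = (\<Sum>i = 1..k. A $ i * (\<Sum>v \<in> weighted_tuples m (k - i). tuple_term (fps_nth A) m v))"
      using less.prems by (intro sum_tuple_term_recursion) auto
    also have "\<dots> = (\<Sum>i = 1..k. A $ i * F $ (k - i))"
      using less False by (intro sum.cong) auto
    also have "\<dots> = (A * F) $ k"
      using \<open>A $ 0 = 0\<close> by (simp add: fps_mult_nth sum.atLeast_Suc_atMost)
    also have "\<dots> = F $ k"
      using arg_cong[OF F, of "\<lambda>f. f $ k"] False by simp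
    finally show ?thesis .
  qed
qed

text \<open>\<open>A\<close> and \<open>a\<close> are compared at positive indices only: in the
  applications \<open>a 0 = 1\<close>, while \<open>A $ 0 = 0\<close>.\<close>

lemma tuples_sum_eq_fps_nth:
  assumes "(1 - A) * F = 1" "A $ 0 = 0" and a: "\<And>i. i \<ge> 1 \<Longrightarrow> A $ i = a i"
  shows "(\<Sum>v \<in> tuples n. multinom n v * (\<Prod>i = 1..n. a i ^ v i)) = F $ n"
proof -
  have "(\<Sum>v \<in> tuples n. multinom n v * (\<Prod>i = 1..n. a i ^ v i))
      = (\<Sum>v \<in> weighted_tuples n n. tuple_term (fps_nth A) n v)"
    unfolding tuples_def weighted_tuples_def tuple_term_def
    using a by (intro sum.cong arg_cong2[where f = "(*)"] prod.cong) auto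
  with assms show ?thesis
    by (simp add: sum_tuple_term_eq_fps_nth)
qed

text \<open>The unsigned case for \<open>- A\<close> produces the sign (-1)^|v|, opposite to the one
  in the sum; hence the minus on the right.\<close>

lemma signed_tuples_sum_eq_fps_nth:
  assumes "(1 + A) * F = 1" "A $ 0 = 0" and a: "\<And>i. i \<ge> 1 \<Longrightarrow> A $ i = a i" and "n \<ge> 1"
  shows "(\<Sum>v \<in> tuples n. (- 1) ^ (tuple_sum n v - 1) * multinom n v * (\<Prod>i = 1..n. a i ^ v i))
    = - F $ n"
proof -
  have "(- 1) ^ (tuple_sum n v - 1) * multinom n v * (\<Prod>i = 1..n. a i ^ v i)
      = - (multinom n v * (\<Prod>i = 1..n. (- a i) ^ v i))" if v: "v \<in> tuples n" for v
  proof -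
    \<comment> \<open>The exponent |v| - 1 is a truncated difference, so the signs are opposite only
      for |v| > 0.\<close>
    have "tuple_sum n v \<noteq> 0"
      using v \<open>n \<ge> 1\<close> tuple_sum_pos[of v n n] by (simp add: tuples_def weighted_tuples_def)
    moreover have "(\<Prod>i = 1..n. (- a i) ^ v i) = (- 1) ^ tuple_sum n v * (\<Prod>i = 1..n. a i ^ v i)"
      by (simp add: power_minus[of "a _"] prod.distrib power_sum tuple_sum_def)
    ultimately show ?thesis
      by (cases "tuple_sum n v") auto
  qed
  then have "(\<Sum>v \<in> tuples n. (- 1) ^ (tuple_sum n v - 1) * multinom n v * (\<Prod>i = 1..n. a i ^ v i))
      = - (\<Sum>v \<in> tuples n. multinom n v * (\<Prod>i = 1..n. (- a i) ^ v i))"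
    by (simp add: sum_negf)
  also have "\<dots> = - F $ n"
    using tuples_sum_eq_fps_nth[of "- A" F "\<lambda>i. - a i" n] assms by simp
  finally show ?thesis .
qed

section \<open>Lagrange inversion\<close>

text \<open>As \<open>g ^ j\<close> vanishes below degree \<open>j\<close>, the single bound
  \<open>j \<le> n\<close> serves all coefficients of the composition up to degree \<open>n\<close>,
  and the sums can be exchanged.\<close>

lemma fps_compose_mult_nth:
  fixes f g h :: "'a :: comm_ring_1 fps"
  assumes "g $ 0 = 0"
  shows "((f oo g) * h) $ n = (\<Sum>j \<le> n. f $ j * (g ^ j * h) $ n)"
proof -
  have "(f oo g) $ i = (\<Sum>j \<le> n. f $ j * (g ^ j) $ i)" if "i \<le> n" for i
    unfolding fps_compose_nth using that startsby_zero_power_prefix[OF assms]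
    by (intro sum.mono_neutral_left) auto
  then have "((f oo g) * h) $ n = (\<Sum>i = 0..n. (\<Sum>j \<le> n. f $ j * (g ^ j) $ i) * h $ (n - i))"
    by (simp add: fps_mult_nth)
  also have "\<dots> = (\<Sum>i = 0..n. \<Sum>j \<le> n. f $ j * (g ^ j $ i * h $ (n - i)))"
    by (simp add: sum_distrib_right mult.assoc)
  also have "\<dots> = (\<Sum>j \<le> n. f $ j * (g ^ j * h) $ n)"
    by (subst sum.swap) (simp add: fps_mult_nth sum_distrib_left)
  finally show ?thesis .
qed

text \<open>In terms of residues: \<open>g\<^sup>j g' / g\<^sup>n\<^sup>+\<^sup>1\<close> is a derivative unless \<open>j = n\<close>.\<close>

lemma lagrange_orthogonality:
  fixes \<phi> :: "'a :: field_char_0 fps"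
  defines "g \<equiv> fps_X * inverse \<phi>"
  assumes \<phi>: "\<phi> $ 0 \<noteq> 0" and "j \<le> n"
  shows "(g ^ j * (fps_deriv g * \<phi> ^ Suc n)) $ n = (if j = n then 1 else 0)"
proof -
  \<comment> \<open>The factor \<open>g ^ j\<close> cancels \<open>j\<close> powers of
    \<open>\<phi>\<close> and shifts by X^j, which leaves the case j = 0 with \<open>m\<close> in
    place of \<open>n\<close>.\<close>
  obtain m where n: "n = m + j" using \<open>j \<le> n\<close> by (metis add.commute le_Suc_ex)
  have inv: "\<phi> * inverse \<phi> = 1" using \<phi> by (simp add: inverse_mult_eq_1')
  have deriv_g: "fps_deriv g = inverse \<phi> - fps_X * fps_deriv \<phi> * (inverse \<phi>)\<^sup>2"
    using \<phi> by (simp add: g_def fps_inverse_deriv)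
  have "fps_deriv g * \<phi> ^ Suc m
      = (\<phi> * inverse \<phi>) * \<phi> ^ m * (1 - fps_X * fps_deriv \<phi> * inverse \<phi>)"
    unfolding deriv_g power_Suc power2_eq_square by (simp add: algebra_simps)
  then have deriv: "fps_deriv g * \<phi> ^ Suc m = \<phi> ^ m * (1 - fps_X * fps_deriv \<phi> * inverse \<phi>)"
    by (simp only: inv mult_1_left)
  have "g ^ j * (fps_deriv g * \<phi> ^ Suc n)
      = fps_X ^ j * (\<phi> * inverse \<phi>) ^ j * (fps_deriv g * \<phi> ^ Suc m)"
    by (simp add: g_def n power_add power_mult_distrib mult_ac)
  also have "\<dots> = fps_X ^ j * (\<phi> ^ m * (1 - fps_X * fps_deriv \<phi> * inverse \<phi>))"
    by (simp only: inv deriv power_one mult_1_right)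
  finally have "(g ^ j * (fps_deriv g * \<phi> ^ Suc n)) $ n
      = (\<phi> ^ m * (1 - fps_X * fps_deriv \<phi> * inverse \<phi>)) $ m"
    by (simp add: n fps_X_power_mult_nth)
  also have "\<dots> = (if m = 0 then 1 else 0)"
  proof (cases m)
    case (Suc k)
    \<comment> \<open>For f = \<open>\<phi> ^ m\<close>, the series multiplied by \<open>m\<close>
      becomes m f - X f', whose coefficient at \<open>m\<close> vanishes. Characteristic 0 allows
      \<open>m\<close> to be cancelled.\<close>
    have deriv_pow: "fps_deriv (\<phi> ^ m) = of_nat m * (fps_deriv \<phi> * \<phi> ^ k)"
      unfolding fps_deriv_power' Suc by (simp add: mult.assoc)
    have "\<phi> ^ m * (1 - fps_X * fps_deriv \<phi> * inverse \<phi>)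
        = \<phi> ^ m - fps_X * (fps_deriv \<phi> * \<phi> ^ k) * (\<phi> * inverse \<phi>)"
      by (simp add: Suc algebra_simps)
    also have "of_nat m * \<dots> = of_nat m * \<phi> ^ m - fps_X * fps_deriv (\<phi> ^ m)"
      unfolding inv deriv_pow by (simp add: algebra_simps)
    finally have "(of_nat m * (\<phi> ^ m * (1 - fps_X * fps_deriv \<phi> * inverse \<phi>))) $ m
        = (of_nat m * \<phi> ^ m - fps_X * fps_deriv (\<phi> ^ m)) $ m"
      by simp
    then have "of_nat m * (\<phi> ^ m * (1 - fps_X * fps_deriv \<phi> * inverse \<phi>)) $ m
        = of_nat m * (\<phi> ^ m) $ m - (fps_X * fps_deriv (\<phi> ^ m)) $ m"
      by (simp only: fps_sub_nth flip: fps_of_nat) (simp only: fps_mult_left_const_nth)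
    also have "\<dots> = 0" by (simp add: Suc del: power_Suc of_nat_Suc)
    finally show ?thesis using Suc by (simp del: of_nat_Suc)
  qed simp
  finally show ?thesis by (simp add: n)
qed

text \<open>The equation makes \<open>w\<close> the compositional inverse of g = X /
  \<open>\<phi>\<close>, so w'(g) g' = 1. After multiplication of \<open>\<phi> ^ Suc n\<close> by
  this 1, orthogonality leaves only the coefficient of w' at \<open>n\<close>.\<close>

theorem lagrange_inversion:
  fixes \<phi> w :: "'a :: field_char_0 fps"
  assumes \<phi>: "\<phi> $ 0 \<noteq> 0" and w: "w $ 0 = 0" "w = fps_X * (\<phi> oo w)"
  shows "of_nat (Suc n) * w $ Suc n = (\<phi> ^ Suc n) $ n"
proof -
  define g where "g = fps_X * inverse \<phi>"
  have g: "g $ 0 = 0" "g $ 1 \<noteq> 0"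
    using \<phi> by (simp_all add: g_def)
  have "(\<phi> oo w) * inverse (\<phi> oo w) = 1"
    using \<phi> by (intro inverse_mult_eq_1') simp
  moreover have "g oo w = w * inverse (\<phi> oo w)"
    using \<phi> w(1) by (simp add: g_def fps_compose_mult_distrib fps_inverse_compose)
  ultimately have "g oo w = fps_X"
    using w(2) by (metis mult.assoc mult.right_neutral)
  \<comment> \<open>So far \<open>w\<close> is only a right inverse of \<open>g\<close>; composing
    with the left inverse \<open>fps_inv g\<close> shows that the two agree.\<close>
  then have "fps_inv g = w"
    using fps_compose_assoc[OF w(1) g(1), of "fps_inv g"] fps_inv[OF g] w(1) by simp
  then have "w oo g = fps_X"
    using fps_inv[OF g] by simp
  then have "(fps_deriv w oo g) * fps_deriv g = 1"
    using fps_compose_deriv[OF g(1), of w] by simp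
  then have "(\<phi> ^ Suc n) $ n = ((fps_deriv w oo g) * (fps_deriv g * \<phi> ^ Suc n)) $ n"
    by (simp add: mult.assoc [symmetric] del: power_Suc)
  also have "\<dots> = (\<Sum>j \<le> n. fps_deriv w $ j * (if j = n then 1 else 0))"
    unfolding fps_compose_mult_nth[OF g(1)] using lagrange_orthogonality[OF \<phi>]
    by (intro sum.cong) (auto simp: g_def simp del: power_Suc)
  also have "\<dots> = of_nat (Suc n) * w $ Suc n"
    by (simp add: if_distrib[of "(*) _"] sum.delta cong: if_cong)
  finally show ?thesis by simp
qed

section \<open>Closed formula for the large Schroeder numbers\<close>

lemma const_plus_fps_X_power_nth:
  fixes c :: "'a :: comm_ring_1"
  shows "((fps_const c + fps_X) ^ n) $ k = of_nat (n choose k) * c ^ (n - k)"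
proof -
  have "((fps_const c + fps_X) ^ n) $ k
      = (\<Sum>j \<le> n. of_nat (n choose j) * (if k = j then c ^ (n - j) else 0))"
    by (simp add: add.commute[of "fps_const c"] binomial_ring fps_sum_nth fps_const_power
        fps_X_power_iff fps_of_nat [symmetric] mult.assoc if_distrib[of "\<lambda>x. x * _"] del: fps_of_nat cong: if_cong)
  also have "\<dots> = (if k \<le> n then of_nat (n choose k) * c ^ (n - k) else 0)"
    by (simp add: if_distrib cong: if_cong)
  finally show ?thesis
    by (simp add: binomial_eq_0)
qed

text \<open>With w = R - 1 the equation reads w = X (1 + w) (2 + w), so for n > 0 Lagrange inversion
  gives n R_n as the coefficient of x^(n-1) in (1 + x)^n (2 + x)^n.\<close>

lemma large_schroeder_gf_unique:
  assumes R: "R = 1 + fps_X * R + fps_X * R\<^sup>2"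
  shows "R $ n = large_schroeder n"
proof (cases n)
  case 0
  then show ?thesis using arg_cong[OF R, of "\<lambda>f. f $ 0"] by (simp add: large_schroeder_def)
next
  case (Suc m)
  define w \<phi> where "w = R - 1" and "\<phi> = (fps_const 1 + fps_X) * (fps_const 2 + fps_X :: rat fps)"
  have w0: "w $ 0 = 0"
    using arg_cong[OF R, of "\<lambda>f. f $ 0"] by (simp add: w_def)
  have "\<phi> oo w = (1 + w) * (fps_const 2 + w)"
    using w0 by (simp add: \<phi>_def fps_compose_mult_distrib fps_compose_add_distrib)
  then have "\<phi> oo w = R + R\<^sup>2"
    by (simp add: w_def algebra_simps power2_eq_square flip: numeral_fps_const)
  then have "w = fps_X * (\<phi> oo w)"
    using R by (simp add: w_def algebra_simps)
  then have "of_nat n * R $ n = (\<phi> ^ n) $ m"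
    using lagrange_inversion[of \<phi> w m] w0 by (simp add: Suc w_def \<phi>_def)
  \<comment> \<open>The exponent of 2 is n - (m - k) = k + 1, as n = m + 1. An index shift and the
    symmetry of the binomials then give the defining sum.\<close>
  also have "\<dots> = (\<Sum>k = 0..m. of_nat (n choose k) * (of_nat (n choose (m - k)) * 2 ^ Suc k))"
    unfolding \<phi>_def power_mult_distrib fps_mult_nth const_plus_fps_X_power_nth
    by (intro sum.cong) (auto simp: Suc Suc_diff_le)
  also have "\<dots> = (\<Sum>k = 1..n. 2 ^ k * of_nat (n choose k) * of_nat (n choose (k - 1)))"
    unfolding Suc One_nat_def sum.atLeast_Suc_atMost_Suc_shift
    by (intro sum.cong) (auto simp: binomial_symmetric[of "Suc _"] simp del: binomial_Suc_Suc)
  finally show ?thesis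
    by (simp add: large_schroeder_def Suc field_simps)
qed

section \<open>First-return decomposition of Schroeder paths\<close>

text \<open>List recursion for paths that start at height \<open>h\<close>, never go below 0 and end
  at 0. The variable height lets inductions pass one step; \<open>descends 0\<close> characterizes
  Schroeder paths.\<close>

fun descends :: "nat \<Rightarrow> step list \<Rightarrow> bool" where
  "descends h [] \<longleftrightarrow> h = 0"
| "descends h (U # p) \<longleftrightarrow> descends (Suc h) p"
| "descends h (D # p) \<longleftrightarrow> h > 0 \<and> descends (h - 1) p"
| "descends h (H # p) \<longleftrightarrow> descends h p"

lemma descends_append: "descends h a \<Longrightarrow> descends k b \<Longrightarrow> descends (h + k) (a @ b)"
proof (induction h a rule: descends.induct)
  case (3 h p)
  then show ?case by (cases h) auto
qed auto

text \<open>The displayed \<open>D\<close> is the first step that reaches height \<open>h\<close>.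
  After an initial \<open>U\<close> two returns are needed, the second in a remainder shorter than
  the tail, hence the induction on length.\<close>

lemma descends_first_return:
  assumes "descends (Suc h) p"
  obtains a b where "p = a @ D # b" "descends 0 a" "descends h b"
  using assms
proof (induction "length p" arbitrary: p h thesis rule: less_induct)
  case less
  show ?case
  proof (cases p)
    case Nil
    with less.prems(2) show ?thesis by simp
  next
    case (Cons x q)
    show ?thesis
    proof (cases x)
      case U
      obtain a r where ar: "q = a @ D # r" "descends 0 a" "descends (Suc h) r"
        using less.hyps[of q "Suc h"] less.prems(2) Cons U by auto
      obtain b c where bc: "r = b @ D # c" "descends 0 b" "descends h c"
        using less.hyps[of r h] ar Cons by auto
      have "descends 0 (U # a @ D # b)"
        using descends_append[of 0 a 1 "D # b"] ar(2) bc(2) by simp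
      with less.prems(1)[of "U # a @ D # b" c] show ?thesis
        using Cons U ar(1) bc(1,3) by simp
    next
      case D
      with less.prems(1)[of "[]" q] less.prems(2) Cons show ?thesis by simp
    next
      case H
      obtain a b where "q = a @ D # b" "descends 0 a" "descends h b"
        using less.hyps[of q h] less.prems(2) Cons H by auto
      with less.prems(1)[of "H # a" b] show ?thesis
        using Cons H by simp
    qed
  qed
qed

text \<open>\<open>a\<close> and \<open>a'\<close> both end at height 0, where a further
  \<open>D\<close> is impossible, so neither extends beyond the \<open>D\<close> that closes the
  other.\<close>

lemma first_return_unique:
  "descends h a \<Longrightarrow> descends h a' \<Longrightarrow> a @ D # b = a' @ D # b' \<Longrightarrow> a = a' \<and> b = b'"
proof (induction h a arbitrary: a' rule: descends.induct)
  case (1 h)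
  then show ?case by (cases a') auto
next
  case (2 h p)
  from "2.prems" obtain r where "a' = U # r" by (cases a') simp_all
  with "2.prems" "2.IH"[of r] show ?case by simp
next
  case (3 h p)
  from "3.prems" obtain r where "a' = D # r" by (cases a') simp_all
  with "3.prems" "3.IH"[of r] show ?case by simp
next
  case (4 h p)
  from "4.prems" obtain r where "a' = H # r" by (cases a') simp_all
  with "4.prems" "4.IH"[of r] show ?case by simp
qed

lemma descends_iff:
  "descends h p \<longleftrightarrow>
    int h + snd (vertex p (length p)) = 0 \<and> (\<forall>i \<le> length p. int h + snd (vertex p i) \<ge> 0)"
proof (induction p arbitrary: h)
  case Nil
  then show ?case by (simp add: vertex_def)
next
  case (Cons x p)
  have all_Suc: "(\<forall>i \<le> Suc l. P i) \<longleftrightarrow> P 0 \<and> (\<forall>i \<le> l. P (Suc i))" for l P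
    by (simp add: All_less_Suc2 flip: less_Suc_eq_le)
  show ?case
  proof (cases x)
    case U
    then show ?thesis
      using Cons[of "Suc h"] by (simp add: vertex_def all_Suc add_ac)
  next
    case D
    show ?thesis
    proof (cases h)
      case 0
      have "\<not> (\<forall>i \<le> length (x # p). int h + snd (vertex (x # p) i) \<ge> 0)"
        using D 0 by (auto simp: vertex_def intro!: exI[of _ 1])
      then show ?thesis using D 0 by simp
    next
      case (Suc k)
      then show ?thesis
        using D Cons[of k] by (simp add: vertex_def all_Suc algebra_simps)
    qed
  next
    case H
    then show ?thesis
      using Cons[of h] by (simp add: vertex_def all_Suc)
  qed
qed

text \<open>In a Schroeder path every \<open>D\<close> is matched by a \<open>U\<close>, and the
  pair is as wide as an \<open>H\<close>, so the remaining steps count half the width.\<close>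

abbreviation semilength :: "step list \<Rightarrow> nat" where
  "semilength p \<equiv> length (filter (\<lambda>s. s \<noteq> D) p)"

lemma sum_list_dx: "descends h p \<Longrightarrow> sum_list (map dx p) = 2 * int (semilength p) + int h"
  by (induction h p rule: descends.induct) auto

lemma schroeder_paths_eq: "schroeder_paths n = {p. descends 0 p \<and> semilength p = n}"
proof -
  have "p \<in> schroeder_paths n \<longleftrightarrow> sum_list (map dx p) = 2 * int n \<and> descends 0 p" for p
    unfolding schroeder_paths_def descends_iff by (auto simp: vertex_def)
  then show ?thesis
    using sum_list_dx[of 0] by auto
qed

lemma schroeder_paths_0: "schroeder_paths 0 = {[]}"
proof -
  have "p = []" if "descends 0 p" "semilength p = 0" for p
    using that by (cases "(0 :: nat, p)" rule: descends.cases) auto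
  then show ?thesis by (auto simp: schroeder_paths_eq)
qed

lemma schroeder_paths_Suc:
  "schroeder_paths (Suc n) = Cons H ` schroeder_paths n \<union>
    (\<lambda>(a, b). U # a @ D # b) ` (\<Union>i \<le> n. schroeder_paths i \<times> schroeder_paths (n - i))"
  (is "?P = ?A \<union> ?f ` ?B")
proof (intro equalityI subsetI)
  fix p assume p: "p \<in> ?P"
  show "p \<in> ?A \<union> ?f ` ?B"
  proof (cases p)
    case Nil
    with p show ?thesis by (simp add: schroeder_paths_eq)
  next
    case (Cons x q)
    show ?thesis
    proof (cases x)
      case U
      with p Cons have "descends (Suc 0) q" "semilength q = n" by (auto simp: schroeder_paths_eq)
      moreover from this(1) obtain a b where "q = a @ D # b" "descends 0 a" "descends 0 b"
        by (rule descends_first_return)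
      ultimately have "(a, b) \<in> ?B" "p = ?f (a, b)"
        using Cons U by (auto simp: schroeder_paths_eq)
      then show ?thesis by blast
    next
      case D
      with p Cons show ?thesis by (simp add: schroeder_paths_eq)
    next
      case H
      with p Cons show ?thesis by (simp add: schroeder_paths_eq)
    qed
  qed
next
  fix p assume "p \<in> ?A \<union> ?f ` ?B"
  then show "p \<in> ?P"
    using descends_append[of 0 _ 1 "D # _"] by (auto simp: schroeder_paths_eq)
qed

text \<open>A weight that factors along the first-return decomposition gives an equation linear in
  its series. The lifted part \<open>a\<close> gets its own weight \<open>c\<close>, since
  statistics that depend on the height change under lifting.\<close>

lemma path_gf_equation:
  fixes w c :: "step list \<Rightarrow> 'a :: comm_ring_1"
  assumes Nil: "w [] = 1"
    and H: "\<And>p. descends 0 p \<Longrightarrow> w (H # p) = q * w p"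
    and U: "\<And>a b. descends 0 a \<Longrightarrow> descends 0 b \<Longrightarrow> w (U # a @ D # b) = c a * w b"
  defines "F \<equiv> Abs_fps (\<lambda>n. \<Sum>p \<in> schroeder_paths n. w p)"
    and "C \<equiv> Abs_fps (\<lambda>n. \<Sum>p \<in> schroeder_paths n. c p)"
  shows "F = 1 + fps_const q * fps_X * F + fps_X * C * F"
proof (rule fps_ext)
  fix n
  show "F $ n = (1 + fps_const q * fps_X * F + fps_X * C * F) $ n"
  proof (cases n)
    case 0
    then show ?thesis by (simp add: F_def schroeder_paths_0 Nil mult.assoc)
  next
    case (Suc m)
    let ?f = "\<lambda>(a, b). U # a @ D # b"
    let ?B = "\<lambda>i. schroeder_paths i \<times> schroeder_paths (m - i)"
    have inj: "inj_on ?f (\<Union>i \<le> m. ?B i)"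
      by (auto simp: inj_on_def schroeder_paths_eq dest: first_return_unique)
    have "F $ n = (\<Sum>p \<in> schroeder_paths m. w (H # p)) + (\<Sum>(a, b) \<in> (\<Union>i \<le> m. ?B i). w (U # a @ D # b))"
      unfolding F_def Suc schroeder_paths_Suc fps_nth_Abs_fps
      by (subst sum.union_disjoint)
        (auto simp: finite_schroeder_paths sum.reindex[OF inj] sum.reindex comp_def intro!: sum.cong)
    also have "(\<Sum>p \<in> schroeder_paths m. w (H # p)) = q * F $ m"
      by (simp add: F_def sum_distrib_left H schroeder_paths_eq)
    \<comment> \<open>The semilength of \<open>a\<close> determines the block, so the blocks are
      disjoint.\<close>
    also have "(\<Sum>(a, b) \<in> (\<Union>i \<le> m. ?B i). w (U # a @ D # b)) = (\<Sum>i \<le> m. \<Sum>(a, b) \<in> ?B i. w (U # a @ D # b))"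
      by (intro sum.UNION_disjoint) (simp_all add: finite_schroeder_paths, auto simp: schroeder_paths_eq)
    also have "\<dots> = (\<Sum>i \<le> m. \<Sum>(a, b) \<in> ?B i. c a * w b)"
      by (intro sum.cong) (auto simp: U schroeder_paths_eq)
    also have "\<dots> = (C * F) $ m"
      by (simp add: C_def F_def fps_mult_nth atLeast0AtMost sum_product sum.cartesian_product)
    finally show ?thesis
      by (simp add: Suc mult.assoc)
  qed
qed

text \<open>Heights in \<open>low\<close> are measured from the origin; a start height
  \<open>h\<close> permits recursion on the first step. \<open>peak_from\<close> does the same for
  peaks of height 1.\<close>

definition low_from :: "int \<Rightarrow> step list \<Rightarrow> nat" where
  "low_from h p = card {i. i < length p \<and> p ! i = H \<and> h + snd (vertex p i) = 0}"

definition peak_from :: "int \<Rightarrow> step list \<Rightarrow> bool" where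
  "peak_from h p \<longleftrightarrow>
    (\<exists>i. Suc i < length p \<and> p ! i = U \<and> h + snd (vertex p (Suc i)) = 1 \<and> p ! Suc i = D)"

lemma low_eq_low_from: "low p = low_from 0 p"
  by (simp add: low_def low_from_def)

lemma has_peak_eq_peak_from: "has_peak_of_height p 1 = peak_from 0 p"
  by (simp add: has_peak_of_height_def peak_from_def)

lemma low_from_Nil [simp]: "low_from h [] = 0"
  by (simp add: low_from_def)

lemma low_from_Cons [simp]:
  "low_from h (x # p) = (if x = H \<and> h = 0 then 1 else 0) + low_from (h + dy x) p"
proof -
  let ?A = "\<lambda>h p. {i. i < length p \<and> p ! i = H \<and> h + snd (vertex p i) = 0}"
  have "?A h (x # p) = (if x = H \<and> h = 0 then {0} else {}) \<union> Suc ` ?A (h + dy x) p"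
    (is "?L = ?R")
  proof (rule set_eqI)
    fix i show "i \<in> ?L \<longleftrightarrow> i \<in> ?R"
      by (cases i) (auto simp: vertex_def add.assoc)
  qed
  then show ?thesis
    unfolding low_from_def by (simp add: card_image card_insert_if)
qed

lemma peak_from_Nil [simp]: "\<not> peak_from h []"
  by (simp add: peak_from_def)

lemma peak_from_Cons [simp]:
  "peak_from h (x # p) \<longleftrightarrow>
    x = U \<and> h = 0 \<and> (\<exists>q. p = D # q) \<or> peak_from (h + dy x) p"
proof -
  have ex: "(\<exists>i. P i) \<longleftrightarrow> P 0 \<or> (\<exists>i. P (Suc i))" for P :: "nat \<Rightarrow> bool"
    by (metis not0_implies_Suc)
  show ?thesis
    unfolding peak_from_def
    by (subst ex) (cases p; auto simp: vertex_def add.assoc)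
qed

text \<open>Started one level higher, \<open>a\<close> stays at height at least 1 up to the
  \<open>D\<close>, so none of its \<open>H\<close> steps is low.\<close>

lemma low_from_first_return:
  "descends k a \<Longrightarrow> low_from (int k + 1) (a @ D # b) = low_from 0 b"
proof (induction k a rule: descends.induct)
  case (2 h p)
  then show ?case by (simp add: add_ac)
next
  case (3 h p)
  then show ?case by (cases h) (simp_all add: add_ac)
qed simp_all

text \<open>The \<open>U\<close> of a peak of height 1 starts on the axis, which the lifted
  \<open>a\<close> never touches.\<close>

lemma peak_from_first_return:
  "descends k a \<Longrightarrow> peak_from (int k + 1) (a @ D # b) = peak_from 0 b"
proof (induction k a rule: descends.induct)
  case (2 h p)
  then show ?case by (simp add: add_ac)
next
  case (3 h p)
  then show ?case by (cases h) (simp_all add: add_ac)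
qed simp_all

lemma low_H: "low (H # p) = Suc (low p)"
  by (simp add: low_eq_low_from)

lemma low_first_return: "descends 0 a \<Longrightarrow> low (U # a @ D # b) = low b"
  using low_from_first_return[of 0 a b] by (simp add: low_eq_low_from)

text \<open>The leading \<open>U\<close> ends at height 1 and \<open>a\<close> cannot begin with
  \<open>D\<close>, so this \<open>U\<close> forms a peak exactly when \<open>a\<close> is
  empty.\<close>

lemma peak_first_return:
  assumes "descends 0 a"
  shows "has_peak_of_height (U # a @ D # b) 1 \<longleftrightarrow> a = [] \<or> has_peak_of_height b 1"
proof -
  have "(\<exists>q. a @ D # b = D # q) \<longleftrightarrow> a = []"
    using assms by (cases a) auto
  then show ?thesis
    using peak_from_first_return[OF assms, of b] by (simp add: has_peak_eq_peak_from)
qed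

section \<open>Generating functions\<close>

text \<open>Defined by counting paths, so that the functional equation comes from the decomposition;
  \<open>large_gf_nth\<close> recovers the closed formula.\<close>

definition large_gf :: "rat fps" where
  "large_gf = Abs_fps (\<lambda>n. of_nat (card (schroeder_paths n)))"

definition small_gf :: "rat fps" where
  "small_gf = Abs_fps small_schroeder"

definition low_gf :: "rat \<Rightarrow> rat fps" where
  "low_gf q = Abs_fps (\<lambda>n. \<Sum>p \<in> schroeder_paths n. q ^ low p)"

definition A114710_gf :: "rat fps" where
  "A114710_gf = Abs_fps (\<lambda>n. of_nat (A114710 n))"

lemma large_gf_equation: "large_gf = 1 + fps_X * large_gf + fps_X * large_gf\<^sup>2"
  using path_gf_equation[of "\<lambda>_. 1 :: rat" 1 "\<lambda>_. 1"]
  by (simp add: large_gf_def power2_eq_square mult.assoc)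

lemma large_gf_nth: "large_gf $ n = large_schroeder n"
  by (rule large_schroeder_gf_unique) (rule large_gf_equation)

lemma small_gf_eq: "small_gf = fps_const (1 / 2) * (1 + large_gf)"
  by (rule fps_ext) (simp add: small_gf_def large_gf_nth small_schroeder_def large_schroeder_def)

lemma low_gf_equation: "low_gf q = 1 + fps_const q * fps_X * low_gf q + fps_X * large_gf * low_gf q"
  unfolding low_gf_def large_gf_def
  using path_gf_equation[of "\<lambda>p. q ^ low p" q "\<lambda>_. 1"]
  by (simp add: low_H low_first_return low_eq_low_from[of "[]"])

lemma A114710_gf_equation: "A114710_gf = 1 + fps_X * (large_gf - 1) * A114710_gf"
proof -
  let ?w = "\<lambda>p. of_bool (low p = 0 \<and> \<not> has_peak_of_height p 1) :: rat"
  have "A114710_gf = Abs_fps (\<lambda>n. \<Sum>p \<in> schroeder_paths n. ?w p)"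
    by (simp add: A114710_gf_def A114710_def finite_schroeder_paths Int_def)
  \<comment> \<open>The empty path occurs only for n = 0, which accounts for the subtracted constant
    1.\<close>
  moreover have "(\<Sum>p \<in> schroeder_paths n. of_bool (p \<noteq> [])) = (large_gf - 1) $ n" for n
  proof -
    have "(\<Sum>p \<in> schroeder_paths n. of_bool (p \<noteq> []))
        = (\<Sum>p \<in> schroeder_paths n. 1 - (if p = [] then 1 else 0) :: rat)"
      by (intro sum.cong) auto
    also have "\<dots> = (large_gf - 1) $ n"
      by (simp add: sum_subtractf large_gf_def finite_schroeder_paths)
        (simp add: schroeder_paths_eq)
    finally show ?thesis .
  qed
  then have "Abs_fps (\<lambda>n. \<Sum>p \<in> schroeder_paths n. of_bool (p \<noteq> [])) = large_gf - 1"
    by (simp add: fps_eq_iff)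
  ultimately show ?thesis
    using path_gf_equation[of ?w 0 "\<lambda>p. of_bool (p \<noteq> [])"]
    by (simp add: low_H low_first_return peak_first_return low_eq_low_from[of "[]"]
        has_peak_eq_peak_from[of "[]"] of_bool_conj)
qed

lemma of_nat_A134425: "of_nat (A134425 n) = low_gf 4 $ n"
  by (simp add: A134425_def low_gf_def)

lemma of_nat_A114710: "of_nat (A114710 n) = A114710_gf $ n"
  by (simp add: A114710_gf_def)

lemma of_nat_A225887: "of_nat (A225887 n) = low_gf 3 $ n"
  by (simp add: A225887_def low_gf_def)

theorem theorem4:
  fixes n :: nat
  assumes "n \<ge> 1"
  shows
    "(n \<ge> 2 \<longrightarrow> (\<Sum>v \<in> tuples n. (- 1) ^ (tuple_sum n v - 1) * multinom n v * (\<Prod>i = 1..n. large_schroeder i ^ v i))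
         = large_schroeder (n - 1)) \<and>
     ((\<Sum>v \<in> tuples n. multinom n v * (\<Prod>i = 1..n. large_schroeder i ^ v i))
         = 2 * of_nat (A134425 (n - 1))) \<and>
     ((\<Sum>v \<in> tuples n. (- 1) ^ (tuple_sum n v - 1) * multinom n v * (\<Prod>i = 1..n. large_schroeder (i - 1) ^ v i))
         = small_schroeder (n - 1)) \<and>
     ((\<Sum>v \<in> tuples n. multinom n v * (\<Prod>i = 1..n. large_schroeder (i - 1) ^ v i))
         = small_schroeder n) \<and>
     ((\<Sum>v \<in> tuples n. (- 1) ^ (tuple_sum n v - 1) * multinom n v * (\<Prod>i = 1..n. small_schroeder i ^ v i))
         = large_schroeder (n - 1)) \<and>
     ((\<Sum>v \<in> tuples n. multinom n v * (\<Prod>i = 1..n. small_schroeder i ^ v i))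
         = of_nat (A225887 (n - 1))) \<and>
     ((\<Sum>v \<in> tuples n. (- 1) ^ (tuple_sum n v - 1) * multinom n v * (\<Prod>i = 1..n. small_schroeder (i - 1) ^ v i))
         = of_nat (A114710 (n - 1))) \<and>
     ((\<Sum>v \<in> tuples n. multinom n v * (\<Prod>i = 1..n. small_schroeder (i - 1) ^ v i))
         = large_schroeder (n - 1)) \<and>
     (n \<ge> 2 \<longrightarrow> (\<Sum>v \<in> tuples n. (- 1) ^ (tuple_sum n v - 1) * multinom n v * (\<Prod>i = 1..n. small_schroeder (i + 1) ^ v i))
         = large_schroeder (n - 1))"
proof -
  \<comment> \<open>The series become opaque letters and 1/2 becomes \<open>c\<close> with 2 c = 1,
    so that the identities below are polynomial consequences within reach of
    \<open>algebra\<close>.\<close>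
  define S s X c where defs: "S = large_gf" "s = small_gf" "X = (fps_X :: rat fps)" "c = fps_const (1 / 2 :: rat)"
  have S: "S = 1 + X * S + X * S\<^sup>2"
    unfolding defs by (rule large_gf_equation)
  have c: "2 * c = 1"
    by (simp add: defs numeral_fps_const)
  have s: "s = c * (1 + S)"
    unfolding defs by (rule small_gf_eq)
  have F4: "low_gf 4 = 1 + 4 * X * low_gf 4 + X * S * low_gf 4"
    using low_gf_equation[of 4] by (simp add: defs flip: numeral_fps_const)
  have F3: "low_gf 3 = 1 + 3 * X * low_gf 3 + X * S * low_gf 3"
    using low_gf_equation[of 3] by (simp add: defs flip: numeral_fps_const)
  have G: "A114710_gf = 1 + X * (S - 1) * A114710_gf"
    unfolding defs by (rule A114710_gf_equation)
  \<comment> \<open>\<open>B\<close> has coefficients s_2, s_3, ... from degree 1 on; the shifted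
    series has constant term s_1 = 1, which is subtracted.\<close>
  define B where "B = fps_shift 1 s - 1"
  have B: "X * B = s - 1 - X"
    by (rule fps_ext) (simp add: B_def defs algebra_simps small_gf_def small_schroeder_def)
  have S_nth: "S $ k = large_schroeder k" and s_nth: "s $ k = small_schroeder k" for k
    by (simp_all add: defs large_gf_nth small_gf_def)
  have B_nth: "B $ k = (if k = 0 then 0 else small_schroeder (k + 1))" for k
    by (simp add: B_def s_nth small_schroeder_def large_schroeder_def)
  have zero: "large_schroeder 0 = 1" "small_schroeder 0 = 1" "small_schroeder 1 = 1"
    by (simp_all add: large_schroeder_def small_schroeder_def)
  have X_nth: "(X * f) $ k = (if k = 0 then 0 else f $ (k - 1))" for f k
    by (simp add: defs)
  have X_nth': "X $ k = (if k = 1 then 1 else 0)" for k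
    by (simp add: defs)
  have numeral_nth: "(numeral m * f) $ k = numeral m * f $ k" for m k and f :: "rat fps"
    by (simp add: numeral_fps_const)
  note nths = S_nth s_nth B_nth X_nth X_nth' zero mult.assoc numeral_nth of_nat_A114710 of_nat_A134425 of_nat_A225887

  \<comment> \<open>Each identity exhibits an inverse whose coefficient at \<open>n\<close>, negated
    in the signed cases, is the right-hand side of a formula. In 1 and 9 a bare multiple of
    \<open>X\<close> disturbs degree 1, hence the restriction to n \<ge> 2.\<close>
  have 1: "(1 + (S - 1)) * (1 - X - X * S) = 1"
    using S by algebra
  have 2: "(1 - (S - 1)) * (1 + 2 * (X * low_gf 4)) = 1"
    using S F4 by algebra
  have 3: "(1 + X * S) * (1 - X * s) = 1"
    using S s c by algebra
  have 4: "(1 - X * S) * s = 1"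
    using S s c by algebra
  have 5: "(1 + (s - 1)) * (1 - X * S) = 1"
    using 4 by (simp add: mult.commute)
  have 6: "(1 - (s - 1)) * (1 + X * low_gf 3) = 1"
    using S s c F3 by algebra
  have 7: "(1 + X * s) * (1 - X * A114710_gf) = 1"
    using S s c G by algebra
  have 8: "(1 - X * s) * (1 + X * S) = 1"
    using 3 by (simp add: mult.commute)
  have 9: "(1 + B) * (1 - 2 * X - X * S) = 1"
  proof -
    \<comment> \<open>\<open>B\<close> is known only through \<open>X * B\<close>, so the identity
      is proved after multiplication by \<open>X\<close>, which then cancels.\<close>
    have "X * ((1 + B) * (1 - 2 * X - X * S)) = X * 1"
      using S s c B by algebra
    then show ?thesis
      by (simp add: defs(3))
  qed
  show ?thesis
    using signed_tuples_sum_eq_fps_nth[OF 1, of large_schroeder n]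
      tuples_sum_eq_fps_nth[OF 2, of large_schroeder n]
      signed_tuples_sum_eq_fps_nth[OF 3, of "\<lambda>i. large_schroeder (i - 1)" n]
      tuples_sum_eq_fps_nth[OF 4, of "\<lambda>i. large_schroeder (i - 1)" n]
      signed_tuples_sum_eq_fps_nth[OF 5, of small_schroeder n]
      tuples_sum_eq_fps_nth[OF 6, of small_schroeder n]
      signed_tuples_sum_eq_fps_nth[OF 7, of "\<lambda>i. small_schroeder (i - 1)" n]
      tuples_sum_eq_fps_nth[OF 8, of "\<lambda>i. small_schroeder (i - 1)" n]
      signed_tuples_sum_eq_fps_nth[OF 9, of "\<lambda>i. small_schroeder (i + 1)" n]
      assms
    by (simp add: nths)
qed

end
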